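(* Let $\{X_i : i\in\mathbb{Z}\}$ be a (strictly) stationary sequence of real random variables with $E[X_1^2]<\infty$. Let $S_k=\sum_{i=1}^k X_i$ and $\mathcal{F}_0=\sigma(X_i: i\le 0)$. Let $n\ge 1$ and $r\ge 0$ be integers such that $2^{r-1}<n\le 2^r$, and let $$\Delta_r=\sum_{j=0}^{r-1}\left\|\frac{E(S_{2^j}\mid\mathcal{F}_0)}{2^{j/2}}\right\| .$$ Then $$E\Big[\max_{1\le i\le n}S_i^2\Big]\le n\big(2\|X_1\|+(1+\sqrt{2})\Delta_r\big)^2 .$$
   Context: Notation: $\|X\|=\sqrt{E(X^2)}$. An empty sum is $0$, so $\Delta_0=0$. *)

theory Defs
  imports "HOL-Probability.Probability"
begin

(* Strict stationarity: the finite-dimensional distributions are shift invariant. *)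
definition strictly_stationary :: "'a measure \<Rightarrow> (int \<Rightarrow> 'a \<Rightarrow> real) \<Rightarrow> bool" where
  "strictly_stationary M X \<longleftrightarrow>
     (\<forall>k. \<forall>J. finite J \<longrightarrow>
        distr M (Pi\<^sub>M J (\<lambda>_. borel)) (\<lambda>\<omega>. \<lambda>i\<in>J. X (i + k) \<omega>) =
        distr M (Pi\<^sub>M J (\<lambda>_. borel)) (\<lambda>\<omega>. \<lambda>i\<in>J. X i \<omega>))"

definition L2norm :: "'a measure \<Rightarrow> ('a \<Rightarrow> real) \<Rightarrow> real" where
  "L2norm M Y = sqrt (\<integral>\<omega>. (Y \<omega>)\<^sup>2 \<partial>M)"

definition partial_sum :: "(int \<Rightarrow> 'a \<Rightarrow> real) \<Rightarrow> nat \<Rightarrow> 'a \<Rightarrow> real" where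
  "partial_sum X k \<omega> = (\<Sum>i=1..int k. X i \<omega>)"

definition past :: "'a measure \<Rightarrow> (int \<Rightarrow> 'a \<Rightarrow> real) \<Rightarrow> 'a measure" where
  "past M X = sigma (space M) {X i -` B \<inter> space M | i B. i \<le> 0 \<and> B \<in> sets borel}"

definition Delta :: "'a measure \<Rightarrow> (int \<Rightarrow> 'a \<Rightarrow> real) \<Rightarrow> nat \<Rightarrow> real" where
  "Delta M X r = (\<Sum>j<r. L2norm M (\<lambda>\<omega>.
     real_cond_exp M (past M X) (partial_sum X (2 ^ j)) \<omega> / 2 powr (real j / 2)))"

end

theory Submission imports Defs
begin

text \<open>
  The proof passes through the scales \<open>1, 2, 4, \<dots>\<close>. Let \<open>Y\<^sub>j\<^sub>,\<^sub>k\<close> be the prediction of the \<open>k\<close>-th block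
  of length \<open>2 ^ j\<close>, that is, the conditional expectation of the sum of \<open>X\<close> over that block given
  everything up to the beginning of the block. By stationarity its norm does not depend on \<open>k\<close>;
  call it \<open>y\<^sub>j\<close>, so that \<open>\<Delta>\<close> is the sum of the \<open>y\<^sub>j / 2 powr (j / 2)\<close>.

  At scale 0, the variable \<open>X\<^sub>k\<close> is its prediction plus a martingale difference. Doob's inequality
  bounds the maximum of the martingale by \<open>2 * sqrt n * L2norm M (X 1)\<close>, and there remain the
  partial sums of the \<open>Y\<^sub>0\<^sub>,\<^sub>k\<close>.

  To go from scale \<open>j\<close> to scale \<open>j + 1\<close>, pair up consecutive blocks. By the tower property, the
  sum of the two predictions in a pair differs from the prediction of the double block only by
  the error made in predicting the second prediction already at the beginning of the pair. These
  errors are martingale differences of norm at most \<open>y\<^sub>j\<close>. With \<open>N = n div 2 ^ j\<close> blocks there are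
  about \<open>N / 2\<close> pairs, so by Doob the errors cost
  \<open>2 * sqrt (N / 2) * y\<^sub>j = sqrt 2 * sqrt N * y\<^sub>j\<close>. A partial sum with an odd number of terms
  contains one unpaired prediction, and the maximum of \<open>N\<close> such variables costs \<open>sqrt N * y\<^sub>j\<close>.
  Since \<open>sqrt N\<close> is at most \<open>sqrt n / 2 powr (j / 2)\<close>, the whole step costs at most
  \<open>(1 + sqrt 2) * sqrt n\<close> times the \<open>j\<close>-th term of \<open>\<Delta>\<close> (lemma \<open>max_predicted_block_step\<close>). The
  recursion stops at scale \<open>r - 1\<close>, where at most two blocks are left and the triangle inequality
  is enough.

  Two tools carry this: Doob's inequality with constant 2 (\<open>Doob_maximal_L2\<close>), which follows from
  a deterministic inequality for running maxima, and the shift invariance of norms of conditional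
  expectations (\<open>L2norm_cond_exp_shift\<close>), obtained by computing them on path space.
\<close>

section \<open>Square integrable functions\<close>

definition sq_integrable :: "'a measure \<Rightarrow> ('a \<Rightarrow> real) \<Rightarrow> bool" where
  "sq_integrable M f \<longleftrightarrow> f \<in> borel_measurable M \<and> integrable M (\<lambda>\<omega>. (f \<omega>)\<^sup>2)"

lemma sq_integrable_measurable: "sq_integrable M f \<Longrightarrow> f \<in> borel_measurable M"
  by (simp add: sq_integrable_def)

lemma sq_integrable_zero: "sq_integrable M (\<lambda>_. 0)"
  by (simp add: sq_integrable_def)

lemma sq_integrable_cmult: "sq_integrable M f \<Longrightarrow> sq_integrable M (\<lambda>\<omega>. c * f \<omega>)"
  by (auto simp: sq_integrable_def power_mult_distrib)

lemma sq_integrable_abs: "sq_integrable M f \<Longrightarrow> sq_integrable M (\<lambda>\<omega>. \<bar>f \<omega>\<bar>)"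
  by (auto simp: sq_integrable_def)

lemma sq_integrable_bound:
  assumes "sq_integrable M g" "f \<in> borel_measurable M" "AE \<omega> in M. \<bar>f \<omega>\<bar> \<le> \<bar>g \<omega>\<bar>"
  shows "sq_integrable M f"
  unfolding sq_integrable_def
proof
  show "integrable M (\<lambda>\<omega>. (f \<omega>)\<^sup>2)"
  proof (rule Bochner_Integration.integrable_bound)
    show "integrable M (\<lambda>\<omega>. (g \<omega>)\<^sup>2)" using assms(1) by (simp add: sq_integrable_def)
    show "AE \<omega> in M. norm ((f \<omega>)\<^sup>2) \<le> norm ((g \<omega>)\<^sup>2)"
      using assms(3) by (auto simp: abs_le_square_iff)
  qed (use assms(2) in measurable)
qed fact

lemma integrable_mult_sq_integrable:
  assumes "sq_integrable M f" "sq_integrable M g"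
  shows "integrable M (\<lambda>\<omega>. f \<omega> * g \<omega>)"
proof (rule Bochner_Integration.integrable_bound)
  have [measurable]: "f \<in> borel_measurable M" "g \<in> borel_measurable M"
    using assms by (auto simp: sq_integrable_def)
  show "integrable M (\<lambda>\<omega>. (f \<omega>)\<^sup>2 + (g \<omega>)\<^sup>2)"
    using assms by (auto simp: sq_integrable_def)
  show "(\<lambda>\<omega>. f \<omega> * g \<omega>) \<in> borel_measurable M" by measurable
  have "\<bar>x * y\<bar> \<le> \<bar>x\<^sup>2 + y\<^sup>2\<bar>" for x y :: real
  proof -
    have "2 * (\<bar>x\<bar> * \<bar>y\<bar>) \<le> x\<^sup>2 + y\<^sup>2"
      using sum_squares_bound[of "\<bar>x\<bar>" "\<bar>y\<bar>"] by (simp add: mult.assoc)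
    moreover have "0 \<le> \<bar>x\<bar> * \<bar>y\<bar>" by simp
    ultimately show ?thesis unfolding abs_mult by linarith
  qed
  then show "AE \<omega> in M. norm (f \<omega> * g \<omega>) \<le> norm ((f \<omega>)\<^sup>2 + (g \<omega>)\<^sup>2)" by simp
qed

lemma sq_integrable_add:
  assumes "sq_integrable M f" "sq_integrable M g"
  shows "sq_integrable M (\<lambda>\<omega>. f \<omega> + g \<omega>)"
proof -
  have "integrable M (\<lambda>\<omega>. (f \<omega>)\<^sup>2 + (g \<omega>)\<^sup>2 + 2 * (f \<omega> * g \<omega>))"
    using assms integrable_mult_sq_integrable[OF assms] by (auto simp: sq_integrable_def)
  moreover have "(\<lambda>\<omega>. (f \<omega> + g \<omega>)\<^sup>2) = (\<lambda>\<omega>. (f \<omega>)\<^sup>2 + (g \<omega>)\<^sup>2 + 2 * (f \<omega> * g \<omega>))"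
    by (simp add: power2_sum mult.assoc)
  ultimately show ?thesis
    using assms unfolding sq_integrable_def by (metis borel_measurable_add)
qed

lemma sq_integrable_diff:
  assumes "sq_integrable M f" "sq_integrable M g"
  shows "sq_integrable M (\<lambda>\<omega>. f \<omega> - g \<omega>)"
  using sq_integrable_add[OF assms(1) sq_integrable_cmult[OF assms(2), of "-1"]] by simp

lemma sq_integrable_sum:
  assumes "\<And>i. i \<in> A \<Longrightarrow> sq_integrable M (f i)"
  shows "sq_integrable M (\<lambda>\<omega>. \<Sum>i\<in>A. f i \<omega>)"
  using assms
  by (induction A rule: infinite_finite_induct)
     (auto intro: sq_integrable_zero sq_integrable_add)

lemma L2norm_nonneg: "0 \<le> L2norm M f"
  by (simp add: L2norm_def)

lemma L2norm_power2: "(L2norm M f)\<^sup>2 = (\<integral>\<omega>. (f \<omega>)\<^sup>2 \<partial>M)"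
  by (simp add: L2norm_def)

lemma L2norm_divide: "0 < c \<Longrightarrow> L2norm M (\<lambda>\<omega>. f \<omega> / c) = L2norm M f / c"
  by (simp add: L2norm_def power_divide real_sqrt_divide)

lemma integral_mult_le_L2norm:
  assumes "sq_integrable M f" "sq_integrable M g"
  shows "(\<integral>\<omega>. f \<omega> * g \<omega> \<partial>M) \<le> L2norm M f * L2norm M g"
proof -
  define a b where "a = L2norm M f" and "b = L2norm M g"
  have ab: "0 \<le> a" "0 \<le> b" by (auto simp: a_def b_def L2norm_nonneg)
  \<comment> \<open>AM-GM with a weight; the shift by e keeps the weight finite when a norm vanishes.\<close>
  have bound: "(\<integral>\<omega>. f \<omega> * g \<omega> \<partial>M) \<le> (a + e) * (b + e)" if e: "0 < e" for e
  proof -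
    define s where "s = (b + e) / (a + e)"
    have s: "0 < s" using e ab by (simp add: s_def)
    have "(\<integral>\<omega>. f \<omega> * g \<omega> \<partial>M) \<le> (\<integral>\<omega>. s * (f \<omega>)\<^sup>2 / 2 + (g \<omega>)\<^sup>2 / (2 * s) \<partial>M)"
    proof (rule integral_mono)
      fix \<omega>
      have "0 \<le> (s * f \<omega> - g \<omega>)\<^sup>2 / (2 * s)" using s by simp
      also have "\<dots> = s * (f \<omega>)\<^sup>2 / 2 + (g \<omega>)\<^sup>2 / (2 * s) - f \<omega> * g \<omega>"
        using s by (simp add: field_simps power2_eq_square)
      finally show "f \<omega> * g \<omega> \<le> s * (f \<omega>)\<^sup>2 / 2 + (g \<omega>)\<^sup>2 / (2 * s)" by simp
    qed (use assms integrable_mult_sq_integrable in \<open>auto simp: sq_integrable_def\<close>)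
    also have "\<dots> = s * a\<^sup>2 / 2 + b\<^sup>2 / (2 * s)"
      using assms by (simp add: sq_integrable_def a_def b_def L2norm_power2)
    also have "\<dots> \<le> s * (a + e)\<^sup>2 / 2 + (b + e)\<^sup>2 / (2 * s)"
      using ab e s by (intro add_mono divide_right_mono mult_left_mono power_mono) auto
    also have "\<dots> = (a + e) * (b + e)"
    proof -
      have "q / p * p\<^sup>2 / 2 + q\<^sup>2 / (2 * (q / p)) = p * q" if "0 < p" "0 < q" for p q :: real
        using that by (simp add: field_simps power2_eq_square)
      from this[of "a + e" "b + e"] show ?thesis using ab e by (simp add: s_def)
    qed
    finally show ?thesis .
  qed
  have "((\<lambda>e. (a + e) * (b + e)) \<longlongrightarrow> (a + 0) * (b + 0)) (at_right 0)"
    by (intro tendsto_intros)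
  moreover have "\<forall>\<^sub>F e in at_right 0. (\<integral>\<omega>. f \<omega> * g \<omega> \<partial>M) \<le> (a + e) * (b + e)"
    using bound by (auto simp: eventually_at_right_field intro: exI[of _ 1])
  ultimately show ?thesis
    using tendsto_lowerbound[of _ _ "at_right (0::real)"] by (auto simp: a_def b_def)
qed

lemma L2norm_triangle:
  assumes "sq_integrable M f" "sq_integrable M g"
  shows "L2norm M (\<lambda>\<omega>. f \<omega> + g \<omega>) \<le> L2norm M f + L2norm M g"
proof (rule power2_le_imp_le)
  have "(L2norm M (\<lambda>\<omega>. f \<omega> + g \<omega>))\<^sup>2 = (\<integral>\<omega>. (f \<omega>)\<^sup>2 + (g \<omega>)\<^sup>2 + 2 * (f \<omega> * g \<omega>) \<partial>M)"
    by (simp add: L2norm_power2 power2_sum mult.assoc)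
  also have "\<dots> = (L2norm M f)\<^sup>2 + (L2norm M g)\<^sup>2 + 2 * (\<integral>\<omega>. f \<omega> * g \<omega> \<partial>M)"
    using assms integrable_mult_sq_integrable[OF assms]
    by (simp add: sq_integrable_def L2norm_power2)
  also have "\<dots> \<le> (L2norm M f + L2norm M g)\<^sup>2"
    using integral_mult_le_L2norm[OF assms] by (simp add: power2_sum)
  finally show "(L2norm M (\<lambda>\<omega>. f \<omega> + g \<omega>))\<^sup>2 \<le> (L2norm M f + L2norm M g)\<^sup>2" .
qed (simp add: L2norm_nonneg)

lemma (in prob_space) integrable_sq_integrable: "sq_integrable M f \<Longrightarrow> integrable M f"
  using square_integrable_imp_integrable by (auto simp: sq_integrable_def)

section \<open>Conditional expectation as an orthogonal projection\<close>

lemma (in prob_space) sigma_finite_subalgebra_of_subalgebra: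
  "subalgebra M F \<Longrightarrow> sigma_finite_subalgebra M F"
  by (rule finite_measure_subalgebra_is_sigma_finite)
     (simp add: finite_measure_subalgebra_def finite_measure_subalgebra_axioms_def
        finite_measure_axioms)

lemma (in prob_space) sq_integrable_real_cond_exp:
  assumes F: "subalgebra M F" and f: "sq_integrable M f"
  shows "sq_integrable M (real_cond_exp M F f)"
proof -
  interpret sigma_finite_subalgebra M F by (rule sigma_finite_subalgebra_of_subalgebra[OF F])
  have "integrable M (\<lambda>\<omega>. (real_cond_exp M F f \<omega>)\<^sup>2)"
    using f integrable_sq_integrable[OF f] emeasure_space_1 
    by (intro integrable_convex_cond_exp[where I=UNIV])
       (auto simp: sq_integrable_def convex_power2)
  then show ?thesis by (simp add: sq_integrable_def)
qed

lemma (in prob_space) cond_exp_residual_orthogonal: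
  assumes F: "subalgebra M F" and f: "sq_integrable M f"
    and W: "sq_integrable M W" "W \<in> borel_measurable F"
  shows "(\<integral>\<omega>. W \<omega> * (f \<omega> - real_cond_exp M F f \<omega>) \<partial>M) = 0"
proof -
  interpret sigma_finite_subalgebra M F by (rule sigma_finite_subalgebra_of_subalgebra[OF F])
  have "(\<integral>\<omega>. W \<omega> * (f \<omega> - real_cond_exp M F f \<omega>) \<partial>M)
      = (\<integral>\<omega>. W \<omega> * f \<omega> - W \<omega> * real_cond_exp M F f \<omega> \<partial>M)"
    by (simp add: right_diff_distrib)
  also have "\<dots> = (\<integral>\<omega>. W \<omega> * f \<omega> \<partial>M) - (\<integral>\<omega>. W \<omega> * real_cond_exp M F f \<omega> \<partial>M)"
    by (intro Bochner_Integration.integral_diff integrable_mult_sq_integrable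
        sq_integrable_real_cond_exp assms)
  also have "\<dots> = 0"
    using real_cond_exp_intg(2)[OF integrable_mult_sq_integrable[OF W(1) f] W(2)]
      sq_integrable_measurable[OF f] by simp
  finally show ?thesis .
qed

lemma (in prob_space) L2norm_cond_exp_residual_le:
  assumes F: "subalgebra M F" and f: "sq_integrable M f"
  shows "L2norm M (\<lambda>\<omega>. f \<omega> - real_cond_exp M F f \<omega>) \<le> L2norm M f"
proof (rule power2_le_imp_le)
  let ?e = "real_cond_exp M F f" 
  let ?d = "\<lambda>\<omega>. f \<omega> - ?e \<omega>"
  have e: "sq_integrable M ?e" by (rule sq_integrable_real_cond_exp[OF F f])
  have d: "sq_integrable M ?d" by (rule sq_integrable_diff[OF f e])
  have "(\<integral>\<omega>. (f \<omega>)\<^sup>2 \<partial>M) = (\<integral>\<omega>. (?d \<omega>)\<^sup>2 + (?e \<omega>)\<^sup>2 + 2 * (?e \<omega> * ?d \<omega>) \<partial>M)"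
    by (intro Bochner_Integration.integral_cong) (auto simp: power2_eq_square algebra_simps)
  also have "\<dots> = (\<integral>\<omega>. (?d \<omega>)\<^sup>2 \<partial>M) + (\<integral>\<omega>. (?e \<omega>)\<^sup>2 \<partial>M) + 2 * (\<integral>\<omega>. ?e \<omega> * ?d \<omega> \<partial>M)"
    using d e integrable_mult_sq_integrable[OF e d] by (simp add: sq_integrable_def)
  also have "(\<integral>\<omega>. ?e \<omega> * ?d \<omega> \<partial>M) = 0"
    by (rule cond_exp_residual_orthogonal[OF F f e]) simp
  finally have "(\<integral>\<omega>. (f \<omega>)\<^sup>2 \<partial>M) = (\<integral>\<omega>. (?d \<omega>)\<^sup>2 \<partial>M) + (\<integral>\<omega>. (?e \<omega>)\<^sup>2 \<partial>M)" by simp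
  moreover have "0 \<le> (\<integral>\<omega>. (?e \<omega>)\<^sup>2 \<partial>M)" by simp
  ultimately show "(L2norm M ?d)\<^sup>2 \<le> (L2norm M f)\<^sup>2" unfolding L2norm_power2 by linarith
qed (rule L2norm_nonneg)

section \<open>Bounds in \<open>L\<^sup>2\<close> for the maximum of finitely many functions\<close>

text \<open>Asking for a square integrable majorant instead of a bound on the norm of the maximum itself
  lets a decomposition of the partial sums be turned into an addition of majorants, without
  handling measurability and integrability of the maximum at each step.\<close>

definition max_L2_le :: "'a measure \<Rightarrow> (nat \<Rightarrow> 'a \<Rightarrow> real) \<Rightarrow> nat \<Rightarrow> real \<Rightarrow> bool" where
  "max_L2_le M S N c \<longleftrightarrow>
     (\<exists>K. sq_integrable M K \<and> (AE \<omega> in M. \<forall>i\<le>N. \<bar>S i \<omega>\<bar> \<le> K \<omega>) \<and> L2norm M K \<le> c)"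

lemma max_L2_le_add:
  assumes "max_L2_le M S N a" "max_L2_le M T N b"
    and "AE \<omega> in M. \<forall>i\<le>N. \<bar>U i \<omega>\<bar> \<le> \<bar>S i \<omega>\<bar> + \<bar>T i \<omega>\<bar>"
  shows "max_L2_le M U N (a + b)"
proof -
  obtain K L where K: "sq_integrable M K" "AE \<omega> in M. \<forall>i\<le>N. \<bar>S i \<omega>\<bar> \<le> K \<omega>" "L2norm M K \<le> a"
    and L: "sq_integrable M L" "AE \<omega> in M. \<forall>i\<le>N. \<bar>T i \<omega>\<bar> \<le> L \<omega>" "L2norm M L \<le> b"
    using assms(1,2) by (auto simp: max_L2_le_def)
  have "AE \<omega> in M. \<forall>i\<le>N. \<bar>U i \<omega>\<bar> \<le> K \<omega> + L \<omega>"
    using K(2) L(2) assms(3) by eventually_elim (meson add_mono order_trans)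
  with K L L2norm_triangle[OF K(1) L(1)] sq_integrable_add[OF K(1) L(1)] show ?thesis
    unfolding max_L2_le_def by (intro exI[of _ "\<lambda>\<omega>. K \<omega> + L \<omega>"]) auto
qed

lemma max_L2_le_mono: "max_L2_le M S N a \<Longrightarrow> a \<le> b \<Longrightarrow> max_L2_le M S N b"
  by (auto simp: max_L2_le_def intro: order_trans)

lemma max_L2_le_reindex:
  assumes "max_L2_le M S N a" "\<And>i. i \<le> N' \<Longrightarrow> g i \<le> N"
  shows "max_L2_le M (\<lambda>i. S (g i)) N' a"
proof -
  obtain K where K: "sq_integrable M K" "AE \<omega> in M. \<forall>i\<le>N. \<bar>S i \<omega>\<bar> \<le> K \<omega>" "L2norm M K \<le> a"
    using assms(1) by (auto simp: max_L2_le_def)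
  have "AE \<omega> in M. \<forall>i\<le>N'. \<bar>S (g i) \<omega>\<bar> \<le> K \<omega>"
    using K(2) by eventually_elim (use assms(2) in blast)
  with K show ?thesis unfolding max_L2_le_def by blast
qed

text \<open>The maximum of squares is at most their sum. The resulting factor \<open>sqrt N\<close> is the order that
  Doob's inequality gives for sums of \<open>N\<close> martingale differences, so isolated terms cost no more
  than the martingale parts.\<close>

lemma max_L2_le_single_terms:
  assumes f: "\<And>k. k < N \<Longrightarrow> sq_integrable M (f k)" "\<And>k. k < N \<Longrightarrow> L2norm M (f k) \<le> y"
    and S: "\<And>i \<omega>. i \<le> N \<Longrightarrow> S i \<omega> = 0 \<or> (\<exists>k<N. S i \<omega> = f k \<omega>)"
    and y: "0 \<le> y"
  shows "max_L2_le M S N (sqrt (real N) * y)"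
proof -
  let ?K = "\<lambda>\<omega>. sqrt (\<Sum>k<N. (f k \<omega>)\<^sup>2)"
  have sq: "(?K \<omega>)\<^sup>2 = (\<Sum>k<N. (f k \<omega>)\<^sup>2)" for \<omega> by (simp add: sum_nonneg)
  have int: "integrable M (\<lambda>\<omega>. (f k \<omega>)\<^sup>2)" if "k < N" for k
    using f(1)[OF that] by (simp add: sq_integrable_def)
  have [measurable]: "f k \<in> borel_measurable M" if "k < N" for k
    using f(1)[OF that] by (simp add: sq_integrable_def)
  have "(\<lambda>\<omega>. \<Sum>k<N. (f k \<omega>)\<^sup>2) \<in> borel_measurable M"
    by (intro borel_measurable_sum borel_measurable_power) auto
  then have meas: "?K \<in> borel_measurable M" by measurable
  have K: "sq_integrable M ?K"
    unfolding sq_integrable_def sq using int meas by auto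
  have "\<bar>S i \<omega>\<bar> \<le> ?K \<omega>" if "i \<le> N" for i \<omega>
  proof -
    have "\<bar>f k \<omega>\<bar> \<le> ?K \<omega>" if "k < N" for k
      using that by (intro real_le_rsqrt) (auto intro!: member_le_sum)
    moreover have "0 \<le> ?K \<omega>" by (simp add: sum_nonneg)
    ultimately show ?thesis using S[OF \<open>i \<le> N\<close>, of \<omega>] by auto
  qed
  moreover have "L2norm M ?K \<le> sqrt (real N) * y"
  proof (rule power2_le_imp_le)
    have "(L2norm M ?K)\<^sup>2 = (\<Sum>k<N. (L2norm M (f k))\<^sup>2)"
      unfolding L2norm_power2 sq using int by (simp add: Bochner_Integration.integral_sum)
    also have "\<dots> \<le> (\<Sum>k<N. y\<^sup>2)"
      by (intro sum_mono power_mono f(2) L2norm_nonneg) auto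
    finally show "(L2norm M ?K)\<^sup>2 \<le> (sqrt (real N) * y)\<^sup>2" by (simp add: power_mult_distrib)
  qed (use y in auto)
  ultimately show ?thesis using K unfolding max_L2_le_def by (intro exI[of _ ?K]) auto
qed

text \<open>The crude counterpart, by the triangle inequality alone; it is of the right order when \<open>N\<close> is
  bounded.\<close>

lemma max_L2_le_sum:
  assumes f: "\<And>k. sq_integrable M (f k)" "\<And>k. L2norm M (f k) \<le> y" and y: "0 \<le> y"
  shows "max_L2_le M (\<lambda>i \<omega>. \<Sum>k<i. f k \<omega>) N (real N * y)"
proof -
  let ?K = "\<lambda>n \<omega>. \<Sum>k<n. \<bar>f k \<omega>\<bar>"
  have K: "sq_integrable M (?K n)" for n
    by (intro sq_integrable_sum sq_integrable_abs f)
  have norm: "L2norm M (?K n) \<le> real n * y" for n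
  proof (induction n)
    case (Suc n)
    have "L2norm M (\<lambda>\<omega>. ?K n \<omega> + \<bar>f n \<omega>\<bar>) \<le> L2norm M (?K n) + L2norm M (\<lambda>\<omega>. \<bar>f n \<omega>\<bar>)"
      by (intro L2norm_triangle K sq_integrable_abs f)
    also have "L2norm M (\<lambda>\<omega>. \<bar>f n \<omega>\<bar>) = L2norm M (f n)" by (simp add: L2norm_def)
    finally show ?case using Suc f(2)[of n] by (simp add: algebra_simps)
  qed (simp add: L2norm_def)
  have "\<bar>\<Sum>k<i. f k \<omega>\<bar> \<le> ?K N \<omega>" if "i \<le> N" for i \<omega>
    by (rule order_trans[OF sum_abs]) (use that in \<open>auto intro!: sum_mono2\<close>)
  then show ?thesis
    unfolding max_L2_le_def using K norm by (intro exI[of _ "?K N"]) auto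
qed

section \<open>Doob's maximal inequality\<close>

fun running_max :: "(nat \<Rightarrow> real) \<Rightarrow> nat \<Rightarrow> real" where
  "running_max s 0 = s 0"
| "running_max s (Suc i) = max (running_max s i) (s (Suc i))"

lemma le_running_max: "i \<le> n \<Longrightarrow> s i \<le> running_max s n"
  by (induction n) (auto simp: le_Suc_eq le_max_iff_disj)

text \<open>A discrete form of \<open>R s = \<integral> R ds + \<integral> s dR\<close>: the running maximum \<open>R\<close> only grows when it
  equals \<open>s\<close>, so the last integral is at least \<open>R\<^sup>2 / 2\<close>.\<close>

lemma half_running_max_sq_le:
  assumes s0: "s 0 = 0"
  shows "(running_max s n)\<^sup>2 / 2 + (\<Sum>i<n. running_max s i * (s (Suc i) - s i))
      \<le> running_max s n * s n"
proof (induction n)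
  case (Suc n)
  show ?case
  proof (cases "s (Suc n) \<le> running_max s n")
    case True
    with Suc show ?thesis by (simp add: max_def algebra_simps)
  next
    case False
    have "0 \<le> (s (Suc n) - running_max s n)\<^sup>2" by simp
    with Suc False show ?thesis
      by (simp add: max_def algebra_simps power2_eq_square)
  qed
qed (simp add: s0)

text \<open>A pathwise form of Doob's inequality: for a nonnegative submartingale the sum on the right
  has nonnegative expectation, and integration yields the constant 4 for squares.\<close>

lemma running_max_sq_le:
  assumes "s 0 = 0"
  shows "(running_max s n)\<^sup>2 \<le> 4 * (s n)\<^sup>2 - 4 * (\<Sum>i<n. running_max s i * (s (Suc i) - s i))"
proof -
  have "0 \<le> (running_max s n / 2 - s n)\<^sup>2" by simp
  then have "running_max s n * s n \<le> (running_max s n)\<^sup>2 / 4 + (s n)\<^sup>2"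
    by (simp add: power2_eq_square algebra_simps)
  with half_running_max_sq_le[of s n, OF assms] show ?thesis by simp
qed

lemma running_max_nonneg:
  assumes "\<And>i. 0 \<le> s i"
  shows "0 \<le> running_max s n"
  using assms by (induction n) (auto simp: le_max_iff_disj)

text \<open>The martingale differences are presented as prediction errors \<open>Z k - E(Z k | G k)\<close>, the form in
  which they occur at every scale. By orthogonality the martingale after \<open>N\<close> steps has squared
  norm at most \<open>N * y\<^sup>2\<close>, and the pathwise inequality is applied to its absolute value.\<close>

lemma (in prob_space) Doob_maximal_L2:
  assumes G: "\<And>k. subalgebra M (G k)" "\<And>k l. k \<le> l \<Longrightarrow> subalgebra (G l) (G k)"
    and Z: "\<And>k. sq_integrable M (Z k)" "\<And>k. Z k \<in> borel_measurable (G (Suc k))"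
    and y: "\<And>k. L2norm M (Z k) \<le> y" "0 \<le> y"
  shows "max_L2_le M (\<lambda>i \<omega>. \<Sum>k<i. Z k \<omega> - real_cond_exp M (G k) (Z k) \<omega>) N (2 * sqrt (real N) * y)"
proof -
  define D where "D k \<omega> = Z k \<omega> - real_cond_exp M (G k) (Z k) \<omega>" for k \<omega>
  define S where "S i \<omega> = (\<Sum>k<i. D k \<omega>)" for i \<omega>
  define R where "R i \<omega> = running_max (\<lambda>j. \<bar>S j \<omega>\<bar>) i" for i \<omega>
  have D: "sq_integrable M (D k)" for k
    unfolding D_def by (intro sq_integrable_diff sq_integrable_real_cond_exp Z G)
  have S: "sq_integrable M (S i)" for i
    unfolding S_def by (intro sq_integrable_sum D)
  have measD: "D k \<in> borel_measurable (G l)" if "k < l" for k l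
  proof -
    have "Z k \<in> borel_measurable (G l)"
      using measurable_from_subalg[OF G(2) Z(2)] that by simp
    moreover have "real_cond_exp M (G k) (Z k) \<in> borel_measurable (G l)"
      using measurable_from_subalg[OF G(2) borel_measurable_cond_exp] that by simp
    ultimately show ?thesis unfolding D_def by measurable
  qed
  have measS: "S i \<in> borel_measurable (G l)" if "i \<le> l" for i l
    unfolding S_def using measD that by (intro borel_measurable_sum) auto
  have measR: "R i \<in> borel_measurable (G l)" if "i \<le> l" for i l
    using that
  proof (induction i)
    case 0
    then show ?case using measS[of 0 l] by (simp add: R_def)
  next
    case (Suc i)
    then have "R i \<in> borel_measurable (G l)" "S (Suc i) \<in> borel_measurable (G l)"
      using measS by auto
    then have "(\<lambda>\<omega>. max (R i \<omega>) \<bar>S (Suc i) \<omega>\<bar>) \<in> borel_measurable (G l)" by measurable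
    then show ?case by (simp add: R_def)
  qed
  have R_nonneg: "0 \<le> R i \<omega>" for i \<omega> unfolding R_def by (rule running_max_nonneg) simp
  have S_le: "\<bar>S j \<omega>\<bar> \<le> R i \<omega>" if "j \<le> i" for i j \<omega>
    unfolding R_def using le_running_max[OF that, of "\<lambda>j. \<bar>S j \<omega>\<bar>"] .
  have R: "sq_integrable M (R i)" for i
  proof (induction i)
    case 0
    then show ?case using sq_integrable_abs[OF S[of 0]] by (simp add: R_def)
  next
    case (Suc i)
    show ?case
    proof (rule sq_integrable_bound)
      show "sq_integrable M (\<lambda>\<omega>. R i \<omega> + \<bar>S (Suc i) \<omega>\<bar>)"
        by (intro sq_integrable_add Suc sq_integrable_abs S)
      show "R (Suc i) \<in> borel_measurable M"
        using measurable_from_subalg[OF G(1) measR] by blast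
      show "AE \<omega> in M. \<bar>R (Suc i) \<omega>\<bar> \<le> \<bar>R i \<omega> + \<bar>S (Suc i) \<omega>\<bar>\<bar>"
        using R_nonneg[of i] by (auto simp: R_def)
    qed
  qed
  have orth: "(\<integral>\<omega>. W \<omega> * D k \<omega> \<partial>M) = 0"
    if "sq_integrable M W" "W \<in> borel_measurable (G k)" for W k
    unfolding D_def by (rule cond_exp_residual_orthogonal[OF G(1) Z(1) that])
  have normS: "(\<integral>\<omega>. (S i \<omega>)\<^sup>2 \<partial>M) \<le> real i * y\<^sup>2" for i
  proof (induction i)
    case 0
    then show ?case by (simp add: S_def)
  next
    case (Suc i)
    have "(\<integral>\<omega>. (S (Suc i) \<omega>)\<^sup>2 \<partial>M) = (\<integral>\<omega>. (S i \<omega>)\<^sup>2 + (D i \<omega>)\<^sup>2 + 2 * (S i \<omega> * D i \<omega>) \<partial>M)"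
      by (simp add: S_def power2_sum mult.assoc)
    also have "\<dots> = (\<integral>\<omega>. (S i \<omega>)\<^sup>2 \<partial>M) + (L2norm M (D i))\<^sup>2 + 2 * (\<integral>\<omega>. S i \<omega> * D i \<omega> \<partial>M)"
      using S[of i] D[of i] integrable_mult_sq_integrable[OF S[of i] D[of i]]
      by (simp add: sq_integrable_def L2norm_power2)
    also have "\<dots> = (\<integral>\<omega>. (S i \<omega>)\<^sup>2 \<partial>M) + (L2norm M (D i))\<^sup>2"
      using orth[OF S measS] by simp
    also have "L2norm M (D i) \<le> y"
      unfolding D_def using L2norm_cond_exp_residual_le[OF G(1) Z(1)] y(1) order_trans by blast
    then have "(L2norm M (D i))\<^sup>2 \<le> y\<^sup>2" by (intro power_mono L2norm_nonneg)
    finally show ?case using Suc by (simp add: algebra_simps)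
  qed
  \<comment> \<open>\<open>A i\<close> is at most \<open>R i * (\<bar>S (Suc i)\<bar> - \<bar>S i\<bar>)\<close>, because \<open>sgn (S i)\<close> is a subgradient of the
    absolute value at \<open>S i\<close>, and it has mean zero.\<close>
  define A where "A i \<omega> = R i \<omega> * sgn (S i \<omega>) * D i \<omega>" for i \<omega>
  have W: "sq_integrable M (\<lambda>\<omega>. R i \<omega> * sgn (S i \<omega>))"
          "(\<lambda>\<omega>. R i \<omega> * sgn (S i \<omega>)) \<in> borel_measurable (G i)" for i
  proof -
    have [measurable]: "R i \<in> borel_measurable (G i)" "S i \<in> borel_measurable (G i)"
      using measR measS by auto
    show *: "(\<lambda>\<omega>. R i \<omega> * sgn (S i \<omega>)) \<in> borel_measurable (G i)" by measurable
    show "sq_integrable M (\<lambda>\<omega>. R i \<omega> * sgn (S i \<omega>))"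
      by (rule sq_integrable_bound[OF R[of i] measurable_from_subalg[OF G(1) *]])
         (auto simp: abs_mult sgn_real_def)
  qed
  have A_int: "integrable M (A i)" for i
    unfolding A_def by (rule integrable_mult_sq_integrable[OF W(1) D])
  have A_mean: "(\<integral>\<omega>. A i \<omega> \<partial>M) = 0" for i
    unfolding A_def by (rule orth[OF W])
  have path: "(R N \<omega>)\<^sup>2 \<le> 4 * (S N \<omega>)\<^sup>2 - 4 * (\<Sum>i<N. A i \<omega>)" for \<omega>
  proof -
    have "A i \<omega> \<le> R i \<omega> * (\<bar>S (Suc i) \<omega>\<bar> - \<bar>S i \<omega>\<bar>)" for i
    proof -
      have "sgn (S i \<omega>) * D i \<omega> \<le> \<bar>S (Suc i) \<omega>\<bar> - \<bar>S i \<omega>\<bar>"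
        by (auto simp: S_def sgn_real_def)
      then show ?thesis
        unfolding A_def mult.assoc by (rule mult_left_mono[OF _ R_nonneg])
    qed
    then have "(\<Sum>i<N. A i \<omega>) \<le> (\<Sum>i<N. R i \<omega> * (\<bar>S (Suc i) \<omega>\<bar> - \<bar>S i \<omega>\<bar>))"
      by (rule sum_mono)
    moreover have "(R N \<omega>)\<^sup>2 \<le> 4 * \<bar>S N \<omega>\<bar>\<^sup>2 - 4 * (\<Sum>i<N. R i \<omega> * (\<bar>S (Suc i) \<omega>\<bar> - \<bar>S i \<omega>\<bar>))"
      unfolding R_def by (rule running_max_sq_le) (simp add: S_def)
    ultimately show ?thesis by simp
  qed
  have "L2norm M (R N) \<le> 2 * sqrt (real N) * y"
  proof (rule power2_le_imp_le)
    have "(L2norm M (R N))\<^sup>2 \<le> (\<integral>\<omega>. 4 * (S N \<omega>)\<^sup>2 - 4 * (\<Sum>i<N. A i \<omega>) \<partial>M)"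
      unfolding L2norm_power2
      by (rule integral_mono) (use R S A_int path in \<open>auto simp: sq_integrable_def\<close>)
    also have "\<dots> = 4 * (\<integral>\<omega>. (S N \<omega>)\<^sup>2 \<partial>M)"
      using S A_int A_mean by (simp add: sq_integrable_def Bochner_Integration.integral_sum)
    also have "\<dots> \<le> (2 * sqrt (real N) * y)\<^sup>2"
      using normS[of N] by (simp add: power_mult_distrib)
    finally show "(L2norm M (R N))\<^sup>2 \<le> (2 * sqrt (real N) * y)\<^sup>2" .
  qed (use y(2) in auto)
  then have "max_L2_le M S N (2 * sqrt (real N) * y)"
    unfolding max_L2_le_def using R S_le by (intro exI[of _ "R N"]) auto
  then show ?thesis unfolding S_def D_def .
qed

section \<open>Stationarity of conditional expectations\<close>

definition shift_process :: "int \<Rightarrow> (int \<Rightarrow> 'a \<Rightarrow> real) \<Rightarrow> int \<Rightarrow> 'a \<Rightarrow> real" where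
  "shift_process k X i = X (i + k)"

text \<open>The law of the whole trajectory, together with the coordinate process on path space, is a
  canonical copy of the process. Anything computed from that copy is the same for all shifts.\<close>

definition trajectory :: "(int \<Rightarrow> 'a \<Rightarrow> real) \<Rightarrow> 'a \<Rightarrow> int \<Rightarrow> real" where
  "trajectory X \<omega> = (\<lambda>i. X i \<omega>)"

definition law :: "'a measure \<Rightarrow> (int \<Rightarrow> 'a \<Rightarrow> real) \<Rightarrow> (int \<Rightarrow> real) measure" where
  "law M X = distr M (\<Pi>\<^sub>M i\<in>UNIV. borel) (trajectory X)"

definition coordinate :: "int \<Rightarrow> (int \<Rightarrow> real) \<Rightarrow> real" where
  "coordinate i x = x i"

lemma trajectory_measurable:
  assumes "\<And>i. X i \<in> borel_measurable M"
  shows "trajectory X \<in> measurable M (\<Pi>\<^sub>M i\<in>UNIV. borel)"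
  unfolding trajectory_def using assms by (rule measurable_abs_UNIV)

lemma coordinate_measurable: "coordinate i \<in> borel_measurable (law M X)"
  unfolding coordinate_def law_def by measurable

lemma shift_0 [simp]: "shift_process 0 X = X"
  by (simp add: shift_process_def fun_eq_iff)

lemma shift_shift [simp]: "shift_process a (shift_process b X) = shift_process (a + b) X"
  by (simp add: shift_process_def fun_eq_iff ac_simps)

text \<open>A probability measure on the infinite product is determined by its values on cylinder sets,
  and these only involve finite-dimensional distributions.\<close>

lemma (in prob_space) law_shift:
  assumes [measurable]: "\<And>i. X i \<in> borel_measurable M" and "strictly_stationary M X"
  shows "law M (shift_process k X) = law M X"
proof (rule measure_eqI_PiM_infinite[where I = UNIV and M = "\<lambda>_. borel"])
  have meas: "trajectory (shift_process a X) \<in> measurable M (\<Pi>\<^sub>M i\<in>UNIV. borel)" for a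
    by (rule trajectory_measurable) (simp add: shift_process_def)
  fix A :: "int \<Rightarrow> real set" and J :: "int set"
  assume J: "finite J" "J \<subseteq> UNIV" and A: "\<And>i. i \<in> J \<Longrightarrow> A i \<in> sets borel"
  have *: "emeasure (law M (shift_process a X)) (prod_emb UNIV (\<lambda>_. borel) J (Pi\<^sub>E J A))
      = emeasure (distr M (Pi\<^sub>M J (\<lambda>_. borel)) (\<lambda>\<omega>. \<lambda>i\<in>J. X (i + a) \<omega>)) (Pi\<^sub>E J A)" for a
  proof -
    have J': "(\<lambda>\<omega>. \<lambda>i\<in>J. X (i + a) \<omega>) \<in> measurable M (Pi\<^sub>M J (\<lambda>_. borel))" by measurable
    have "trajectory (shift_process a X) -` prod_emb UNIV (\<lambda>_. borel) J (Pi\<^sub>E J A) \<inter> space M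
      = (\<lambda>\<omega>. \<lambda>i\<in>J. X (i + a) \<omega>) -` Pi\<^sub>E J A \<inter> space M"
      by (auto simp: trajectory_def shift_process_def prod_emb_def PiE_iff)
    then show ?thesis
      unfolding law_def using J A meas J'
      by (subst (1 2) emeasure_distr) (auto intro!: sets_PiM_I_finite)
  qed
  show "emeasure (law M (shift_process k X)) (prod_emb UNIV (\<lambda>_. borel) J (Pi\<^sub>E J A))
      = emeasure (law M X) (prod_emb UNIV (\<lambda>_. borel) J (Pi\<^sub>E J A))"
    using *[of k] *[of 0] assms(2) J(1) by (simp add: strictly_stationary_def)
next
  show "finite_measure (law M (shift_process k X))"
    unfolding law_def
    by (intro prob_space.axioms(1) prob_space_distr trajectory_measurable) (simp add: shift_process_def)
qed (simp_all add: law_def)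

lemma space_past [simp]: "space (past M X) = space M"
  unfolding past_def by (rule space_measure_of) auto

lemma sets_past:
  "sets (past M X) = sigma_sets (space M) {X i -` B \<inter> space M | i B. i \<le> 0 \<and> B \<in> sets borel}"
  unfolding past_def by (rule sets_measure_of) auto

lemma measurable_past: "i \<le> 0 \<Longrightarrow> X i \<in> borel_measurable (past M X)"
  by (rule measurableI) (auto simp: sets_past)

lemma subalgebra_past:
  assumes "\<And>i. X i \<in> borel_measurable M"
  shows "subalgebra M (past M X)"
proof -
  have "sigma_sets (space M) {X i -` B \<inter> space M | i B. i \<le> 0 \<and> B \<in> sets borel} \<subseteq> sets M"
    using measurable_sets[OF assms] by (intro sets.sigma_sets_subset) auto
  then show ?thesis by (simp add: subalgebra_def sets_past)
qed

lemma subalgebra_past_shift: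
  assumes "a \<le> b"
  shows "subalgebra (past M (shift_process b X)) (past M (shift_process a X))"
proof -
  have "{shift_process a X i -` B \<inter> space M | i B. i \<le> 0 \<and> B \<in> sets borel}
      \<subseteq> {shift_process b X i -` B \<inter> space M | i B. i \<le> 0 \<and> B \<in> sets borel}"
  proof safe
    fix i :: int and B :: "real set" assume "i \<le> 0" "B \<in> sets borel"
    with assms show "\<exists>i' B'. shift_process a X i -` B \<inter> space M = shift_process b X i' -` B' \<inter> space M
        \<and> i' \<le> 0 \<and> B' \<in> sets borel"
      by (intro exI[of _ "i + a - b"] exI[of _ B]) (auto simp: shift_process_def)
  qed
  then show ?thesis by (simp add: subalgebra_def sets_past sigma_sets_mono')
qed

lemma sets_past_path:
  assumes "\<And>i. X i \<in> borel_measurable M"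
  shows "sets (past M X) = {trajectory X -` B \<inter> space M | B. B \<in> sets (past (law M X) coordinate)}"
proof -
  let ?L = "law M X"
  have sp: "space ?L = UNIV" by (simp add: law_def space_PiM)
  have "{trajectory X -` B \<inter> space M | B. B \<in> sets (past ?L coordinate)}
    = sigma_sets (space M) {trajectory X -` A \<inter> space M | A.
        A \<in> {coordinate i -` B \<inter> space ?L | i B. i \<le> 0 \<and> B \<in> sets borel}}"
    unfolding sets_past by (rule sigma_sets_vimage_commute) (simp add: sp)
  also have "{trajectory X -` A \<inter> space M | A.
        A \<in> {coordinate i -` B \<inter> space ?L | i B. i \<le> 0 \<and> B \<in> sets borel}}
      = {X i -` B \<inter> space M | i B. i \<le> 0 \<and> B \<in> sets borel}"
  proof -
    have eq: "trajectory X -` (coordinate i -` B \<inter> space ?L) = X i -` B" for i B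
      by (auto simp: sp trajectory_def coordinate_def)
    show ?thesis
    proof safe
      fix i :: int and B :: "real set" assume "i \<le> 0" "B \<in> sets borel"
      then show "\<exists>i' B'. trajectory X -` (coordinate i -` B \<inter> space ?L) \<inter> space M = X i' -` B' \<inter> space M
          \<and> i' \<le> 0 \<and> B' \<in> sets borel"
        unfolding eq by blast
    next
      fix i :: int and B :: "real set" assume "i \<le> 0" "B \<in> sets borel"
      then show "\<exists>A. X i -` B \<inter> space M = trajectory X -` A \<inter> space M
          \<and> A \<in> {coordinate i -` B \<inter> space ?L | i B. i \<le> 0 \<and> B \<in> sets borel}"
        unfolding eq[symmetric] by blast
    qed
  qed
  finally show ?thesis by (simp add: sets_past)
qed

text \<open>Conditioning commutes with passing to path space, because the past of \<open>X\<close> is the preimage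
  of the past of the coordinate process.\<close>

lemma (in prob_space) real_cond_exp_path:
  assumes X: "\<And>i. X i \<in> borel_measurable M" and f: "integrable (law M X) f"
  shows "AE \<omega> in M. real_cond_exp M (past M X) (\<lambda>\<omega>. f (trajectory X \<omega>)) \<omega>
      = real_cond_exp (law M X) (past (law M X) coordinate) f (trajectory X \<omega>)"
proof -
  let ?L = "law M X" and ?P = "past (law M X) coordinate"
  interpret L: prob_space ?L
    unfolding law_def by (rule prob_space_distr[OF trajectory_measurable[OF X]])
  interpret sigma_finite_subalgebra M "past M X"
    by (rule sigma_finite_subalgebra_of_subalgebra[OF subalgebra_past[OF X]])
  have subL: "subalgebra ?L ?P" by (rule subalgebra_past) (rule coordinate_measurable)
  interpret LS: sigma_finite_subalgebra ?L ?P
    by (rule L.sigma_finite_subalgebra_of_subalgebra[OF subL])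
  let ?g = "real_cond_exp ?L ?P f"
  have g: "integrable ?L ?g" by (rule LS.real_cond_exp_int(1)[OF f])
  have path: "trajectory X \<in> measurable M (\<Pi>\<^sub>M i\<in>UNIV. borel)" by (rule trajectory_measurable[OF X])
  have transfer: "(\<integral>\<omega>\<in>trajectory X -` B \<inter> space M. h (trajectory X \<omega>) \<partial>M) = (\<integral>x\<in>B. h x \<partial>?L)"
    if B: "B \<in> sets ?L" and h: "integrable ?L h" for B and h :: "_ \<Rightarrow> real"
  proof -
    have [measurable]: "h \<in> borel_measurable (\<Pi>\<^sub>M i\<in>UNIV. borel)" "B \<in> sets (\<Pi>\<^sub>M i\<in>UNIV. borel)"
      using B borel_measurable_integrable[OF h] by (simp_all add: law_def)
    have "(\<integral>x\<in>B. h x \<partial>?L) = (\<integral>\<omega>. indicator B (trajectory X \<omega>) *\<^sub>R h (trajectory X \<omega>) \<partial>M)"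
      unfolding set_lebesgue_integral_def law_def by (rule integral_distr[OF path]) measurable
    also have "\<dots> = (\<integral>\<omega>\<in>trajectory X -` B \<inter> space M. h (trajectory X \<omega>) \<partial>M)"
      unfolding set_lebesgue_integral_def
      by (rule Bochner_Integration.integral_cong) (auto simp: indicator_def)
    finally show ?thesis by simp
  qed
  show ?thesis
  proof (rule real_cond_exp_charact)
    fix A assume "A \<in> sets (past M X)"
    then obtain B where A: "A = trajectory X -` B \<inter> space M" and B: "B \<in> sets ?P"
      by (auto simp: sets_past_path[OF X])
    have BL: "B \<in> sets ?L" using B subL by (auto simp: subalgebra_def)
    show "(\<integral>\<omega>\<in>A. f (trajectory X \<omega>) \<partial>M) = (\<integral>\<omega>\<in>A. ?g (trajectory X \<omega>) \<partial>M)"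
      unfolding A transfer[OF BL f] transfer[OF BL g] by (rule LS.real_cond_exp_intA[OF f B])
  next
    show "integrable M (\<lambda>\<omega>. f (trajectory X \<omega>))" "integrable M (\<lambda>\<omega>. ?g (trajectory X \<omega>))"
      using f g unfolding law_def by (auto intro: integrable_distr[OF path])
  next
    have "trajectory X \<in> measurable (past M X) ?P"
    proof (rule measurableI)
      show "trajectory X -` A \<inter> space (past M X) \<in> sets (past M X)" if "A \<in> sets ?P" for A
        using that by (auto simp: sets_past_path[OF X])
    qed (simp add: law_def space_PiM)
    then show "(\<lambda>\<omega>. ?g (trajectory X \<omega>)) \<in> borel_measurable (past M X)"
      by (rule measurable_compose) simp
  qed
qed

lemma L2norm_cong_AE:
  assumes "f \<in> borel_measurable M" "g \<in> borel_measurable M" "AE \<omega> in M. f \<omega> = g \<omega>"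
  shows "L2norm M f = L2norm M g"
proof -
  have "(\<integral>\<omega>. (f \<omega>)\<^sup>2 \<partial>M) = (\<integral>\<omega>. (g \<omega>)\<^sup>2 \<partial>M)"
    using assms by (intro integral_cong_AE) auto
  then show ?thesis by (simp add: L2norm_def)
qed

lemma L2norm_path:
  assumes X: "\<And>i. X i \<in> borel_measurable M" and f: "f \<in> borel_measurable (law M X)"
  shows "L2norm M (\<lambda>\<omega>. f (trajectory X \<omega>)) = L2norm (law M X) f"
proof -
  have [measurable]: "f \<in> borel_measurable (\<Pi>\<^sub>M i\<in>UNIV. borel)" using f by (simp add: law_def)
  have "(\<integral>x. (f x)\<^sup>2 \<partial>law M X) = (\<integral>\<omega>. (f (trajectory X \<omega>))\<^sup>2 \<partial>M)"
    unfolding law_def by (rule integral_distr[OF trajectory_measurable[OF X]]) measurable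
  then show ?thesis by (simp add: L2norm_def)
qed

lemma sq_integrable_path:
  assumes X: "\<And>i. X i \<in> borel_measurable M" and f: "f \<in> borel_measurable (law M X)"
  shows "sq_integrable M (\<lambda>\<omega>. f (trajectory X \<omega>)) \<longleftrightarrow> sq_integrable (law M X) f"
proof -
  have fm[measurable]: "f \<in> borel_measurable (\<Pi>\<^sub>M i\<in>UNIV. borel)" using f by (simp add: law_def)
  have "integrable (law M X) (\<lambda>x. (f x)\<^sup>2) = integrable M (\<lambda>\<omega>. (f (trajectory X \<omega>))\<^sup>2)"
    unfolding law_def by (rule integrable_distr_eq[OF trajectory_measurable[OF X]]) measurable
  then show ?thesis
    using f measurable_compose[OF trajectory_measurable[OF X] fm] by (simp add: sq_integrable_def)
qed

lemma partial_sum_path: "partial_sum X m \<omega> = partial_sum coordinate m (trajectory X \<omega>)"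
  by (simp add: partial_sum_def coordinate_def trajectory_def)

lemma partial_sum_measurable:
  "(\<And>i. X i \<in> borel_measurable M) \<Longrightarrow> partial_sum X m \<in> borel_measurable M"
  unfolding partial_sum_def by measurable

lemma partial_sum_add: "partial_sum X (a + b) \<omega> = partial_sum X a \<omega> + partial_sum (shift_process (int a) X) b \<omega>"
proof -
  have "{1..int (a + b)} = {1..int a} \<union> {int a + 1..int (a + b)}" by auto
  then have "partial_sum X (a + b) \<omega> = partial_sum X a \<omega> + (\<Sum>i=int a + 1..int (a + b). X i \<omega>)"
    unfolding partial_sum_def by (simp only:) (rule sum.union_disjoint, auto)
  also have "(\<Sum>i=int a + 1..int (a + b). X i \<omega>) = partial_sum (shift_process (int a) X) b \<omega>"
    unfolding partial_sum_def
    by (rule sum.reindex_bij_witness[of _ "\<lambda>i. i + int a" "\<lambda>i. i - int a"]) (auto simp: shift_process_def)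
  finally show ?thesis .
qed

lemma partial_sum_1: "partial_sum X 1 = X 1"
  by (simp add: partial_sum_def fun_eq_iff)

lemma partial_sum_0: "partial_sum X 0 \<omega> = 0"
  by (simp add: partial_sum_def)

section \<open>Stationary square integrable processes\<close>

locale stationary_L2_process = prob_space M for M :: "'a measure" +
  fixes X :: "int \<Rightarrow> 'a \<Rightarrow> real"
  assumes X_measurable: "\<And>i. X i \<in> borel_measurable M"
    and X_stationary: "strictly_stationary M X"
    and X_sq_integrable: "integrable M (\<lambda>\<omega>. (X 1 \<omega>)\<^sup>2)"
begin

lemma shift_measurable: "shift_process k X i \<in> borel_measurable M"
  by (simp add: shift_process_def X_measurable)

lemma law_shift_X: "law M (shift_process k X) = law M X"
  by (rule law_shift[OF X_measurable X_stationary])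

lemma
  shows sq_integrable_X: "sq_integrable M (X i)"
    and L2norm_X: "L2norm M (X i) = L2norm M (X 1)"
proof -
  have eq: "X (1 + k) = (\<lambda>\<omega>. coordinate 1 (trajectory (shift_process k X) \<omega>))" for k
    by (simp add: coordinate_def trajectory_def shift_process_def)
  have sq: "sq_integrable M (X (1 + k)) = sq_integrable (law M X) (coordinate 1)" for k
    unfolding eq sq_integrable_path[OF shift_measurable coordinate_measurable] law_shift_X ..
  have nm: "L2norm M (X (1 + k)) = L2norm (law M X) (coordinate 1)" for k
    unfolding eq L2norm_path[OF shift_measurable coordinate_measurable] law_shift_X ..
  show "sq_integrable M (X i)"
    using sq[of 0] sq[of "i - 1"] X_sq_integrable X_measurable by (simp add: sq_integrable_def)
  show "L2norm M (X i) = L2norm M (X 1)"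
    using nm[of 0] nm[of "i - 1"] by simp
qed

lemma sq_integrable_partial_sum: "sq_integrable M (partial_sum (shift_process k X) m)"
  unfolding partial_sum_def shift_process_def by (intro sq_integrable_sum sq_integrable_X)

text \<open>Both conditional expectations are the same function on path space, evaluated along
  trajectories with the same law.\<close>

lemma L2norm_cond_exp_shift:
  "L2norm M (real_cond_exp M (past M (shift_process k X)) (partial_sum (shift_process k X) m))
   = L2norm M (real_cond_exp M (past M X) (partial_sum X m))"
proof -
  let ?L = "law M X"
  interpret L: prob_space ?L
    unfolding law_def by (rule prob_space_distr[OF trajectory_measurable[OF X_measurable]])
  define h where "h = real_cond_exp ?L (past ?L coordinate) (partial_sum coordinate m)"
  have "partial_sum coordinate m \<in> borel_measurable ?L"
    by (rule partial_sum_measurable) (rule coordinate_measurable)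
  then have "sq_integrable ?L (partial_sum coordinate m)"
    using sq_integrable_path[OF X_measurable, of "partial_sum coordinate m"]
      sq_integrable_partial_sum[of 0 m] by (simp flip: partial_sum_path)
  then have int: "integrable ?L (partial_sum coordinate m)" by (rule L.integrable_sq_integrable)
  have "L2norm M (real_cond_exp M (past M (shift_process k X)) (partial_sum (shift_process k X) m)) = L2norm ?L h" for k
  proof -
    have "AE \<omega> in M. real_cond_exp M (past M (shift_process k X)) (partial_sum (shift_process k X) m) \<omega>
        = h (trajectory (shift_process k X) \<omega>)"
      using real_cond_exp_path[where X = "shift_process k X" and f = "partial_sum coordinate m",
          OF shift_measurable] int
      by (simp add: law_shift_X h_def flip: partial_sum_path)
    moreover have "(\<lambda>\<omega>. h (trajectory (shift_process k X) \<omega>)) \<in> borel_measurable M"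
      by (rule measurable_compose[OF trajectory_measurable[where X = "shift_process k X", OF shift_measurable]])
         (use borel_measurable_cond_exp2[of ?L "past ?L coordinate"] in \<open>simp add: h_def law_def\<close>)
    ultimately have "L2norm M (real_cond_exp M (past M (shift_process k X)) (partial_sum (shift_process k X) m))
        = L2norm M (\<lambda>\<omega>. h (trajectory (shift_process k X) \<omega>))"
      by (intro L2norm_cong_AE) auto
    also have "\<dots> = L2norm ?L h"
      using L2norm_path[where X = "shift_process k X" and f = h, OF shift_measurable] by (simp add: law_shift_X h_def)
    finally show ?thesis .
  qed
  from this[of k] this[of 0] show ?thesis by simp
qed

section \<open>Dyadic blocks\<close>

text \<open>The block with number \<open>k\<close>, counted from 0, consists of the times \<open>k * 2 ^ j + 1, \<dots>,
  (k + 1) * 2 ^ j\<close>, and \<open>block_past j k\<close> is generated by the process up to time \<open>k * 2 ^ j\<close>.\<close>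

definition block :: "nat \<Rightarrow> nat \<Rightarrow> 'a \<Rightarrow> real" where
  "block j k = partial_sum (shift_process (int k * 2 ^ j) X) (2 ^ j)"

definition block_past :: "nat \<Rightarrow> nat \<Rightarrow> 'a measure" where
  "block_past j k = past M (shift_process (int k * 2 ^ j) X)"

definition predicted_block :: "nat \<Rightarrow> nat \<Rightarrow> 'a \<Rightarrow> real" where
  "predicted_block j k = real_cond_exp M (block_past j k) (block j k)"

definition predicted_norm :: "nat \<Rightarrow> real" where
  "predicted_norm j = L2norm M (real_cond_exp M (past M X) (partial_sum X (2 ^ j)))"

lemma subalgebra_block_past: "subalgebra M (block_past j k)"
  unfolding block_past_def by (rule subalgebra_past[OF shift_measurable])

lemma subalgebra_block_past_mono: "k \<le> l \<Longrightarrow> subalgebra (block_past j l) (block_past j k)"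
  unfolding block_past_def by (rule subalgebra_past_shift) simp

lemma block_past_Suc: "block_past (Suc j) k = block_past j (2 * k)"
  by (simp add: block_past_def mult.assoc mult.left_commute)

lemma sq_integrable_block: "sq_integrable M (block j k)"
  unfolding block_def by (rule sq_integrable_partial_sum)

lemma sq_integrable_predicted_block: "sq_integrable M (predicted_block j k)"
  unfolding predicted_block_def
  by (rule sq_integrable_real_cond_exp[OF subalgebra_block_past sq_integrable_block])

lemma L2norm_predicted_block: "L2norm M (predicted_block j k) = predicted_norm j"
  unfolding predicted_block_def predicted_norm_def block_past_def block_def
  by (rule L2norm_cond_exp_shift)

lemma predicted_norm_nonneg: "0 \<le> predicted_norm j"
  unfolding predicted_norm_def by (rule L2norm_nonneg)

lemma predicted_block_measurable: "k \<le> l \<Longrightarrow> predicted_block j k \<in> borel_measurable (block_past j l)"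
  unfolding predicted_block_def
  by (rule measurable_from_subalg[OF subalgebra_block_past_mono borel_measurable_cond_exp])

lemma block_Suc: "block (Suc j) l \<omega> = block j (2 * l) \<omega> + block j (2 * l + 1) \<omega>"
proof -
  have "int l * 2 ^ Suc j = int (2 * l) * 2 ^ j" "(2::nat) ^ Suc j = 2 ^ j + 2 ^ j"
    and "int (2 ^ j) + int (2 * l) * 2 ^ j = int (2 * l + 1) * 2 ^ j"
    by (simp_all add: distrib_right)
  then show ?thesis
    unfolding block_def by (simp only: partial_sum_add shift_shift)
qed

lemma block_Suc_fun: "block (Suc j) l = (\<lambda>\<omega>. block j (2 * l) \<omega> + block j (2 * l + 1) \<omega>)"
  by (rule ext) (rule block_Suc)

text \<open>The first block of a pair starts with the double block, so its prediction is unchanged; the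
  prediction of the second block is projected further back.\<close>

lemma predicted_block_Suc:
  "AE \<omega> in M. predicted_block (Suc j) l \<omega> = predicted_block j (2 * l) \<omega>
     + real_cond_exp M (block_past j (2 * l)) (predicted_block j (2 * l + 1)) \<omega>"
proof -
  interpret sigma_finite_subalgebra M "block_past j (2 * l)"
    by (rule sigma_finite_subalgebra_of_subalgebra[OF subalgebra_block_past])
  have int: "integrable M (block j k)" for k
    by (rule integrable_sq_integrable[OF sq_integrable_block])
  have "AE \<omega> in M. real_cond_exp M (block_past j (2 * l)) (\<lambda>\<omega>. block j (2 * l) \<omega> + block j (2 * l + 1) \<omega>) \<omega>
      = real_cond_exp M (block_past j (2 * l)) (block j (2 * l)) \<omega>
        + real_cond_exp M (block_past j (2 * l)) (block j (2 * l + 1)) \<omega>"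
    by (rule real_cond_exp_add[OF int int])
  \<comment> \<open>tower property: the start of the pair precedes the start of its second block\<close>
  moreover have "AE \<omega> in M. real_cond_exp M (block_past j (2 * l))
        (real_cond_exp M (block_past j (2 * l + 1)) (block j (2 * l + 1))) \<omega>
      = real_cond_exp M (block_past j (2 * l)) (block j (2 * l + 1)) \<omega>"
    by (rule real_cond_exp_nested_subalg[OF subalgebra_block_past subalgebra_block_past_mono int]) simp
  ultimately show ?thesis
    unfolding predicted_block_def block_past_Suc block_Suc_fun by eventually_elim simp
qed

lemma (in -) sum_pairs:
  fixes a :: "nat \<Rightarrow> real"
  shows "(\<Sum>k<i. a k) = (\<Sum>l<i div 2. a (2 * l) + a (2 * l + 1)) + (if odd i then a (i - 1) else 0)"
proof -
  have even: "(\<Sum>k<2 * m. a k) = (\<Sum>l<m. a (2 * l) + a (2 * l + 1))" for m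
    by (induction m) (simp_all add: add.assoc)
  show ?thesis
  proof (cases "even i")
    case True
    then obtain m where "i = 2 * m" by (rule evenE)
    then show ?thesis by (simp add: even)
  next
    case False
    then obtain m where "i = 2 * m + 1" by (rule oddE)
    then show ?thesis by (simp add: even)
  qed
qed

text \<open>The three summands of the bound come from the double blocks, from the martingale of the errors
  \<open>D\<close> made in projecting the second predictions back, and from the unpaired last prediction in a
  sum of odd length.\<close>

lemma max_predicted_block_step:
  assumes "max_L2_le M (\<lambda>i \<omega>. \<Sum>l<i. predicted_block (Suc j) l \<omega>) (N div 2) c"
  shows "max_L2_le M (\<lambda>i \<omega>. \<Sum>k<i. predicted_block j k \<omega>) N
    (c + 2 * sqrt (real (N div 2)) * predicted_norm j + sqrt (real N) * predicted_norm j)"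
proof -
  let ?Y = "predicted_block"
  let ?E = "\<lambda>l. real_cond_exp M (block_past j (2 * l)) (?Y j (2 * l + 1))"
  define D where "D l \<omega> = ?Y j (2 * l + 1) \<omega> - ?E l \<omega>" for l \<omega>
  define last where "last i \<omega> = (if odd i then ?Y j (i - 1) \<omega> else 0)" for i \<omega>
  have half: "i div 2 \<le> N div 2" if "i \<le> N" for i using that by (rule div_le_mono)
  have "max_L2_le M (\<lambda>i \<omega>. \<Sum>l<i. D l \<omega>) (N div 2) (2 * sqrt (real (N div 2)) * predicted_norm j)"
    unfolding D_def
    by (rule Doob_maximal_L2)
       (auto simp: subalgebra_block_past subalgebra_block_past_mono sq_integrable_predicted_block
          predicted_block_measurable L2norm_predicted_block predicted_norm_nonneg)
  then have mart: "max_L2_le M (\<lambda>i \<omega>. \<Sum>l<i div 2. D l \<omega>) N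
      (2 * sqrt (real (N div 2)) * predicted_norm j)"
    using half by (rule max_L2_le_reindex)
  have coarse: "max_L2_le M (\<lambda>i \<omega>. \<Sum>l<i div 2. ?Y (Suc j) l \<omega>) N c"
    using max_L2_le_reindex[OF assms half] .
  have single: "max_L2_le M last N (sqrt (real N) * predicted_norm j)"
  proof (rule max_L2_le_single_terms)
    show "last i \<omega> = 0 \<or> (\<exists>k<N. last i \<omega> = ?Y j k \<omega>)" if "i \<le> N" for i \<omega>
    proof (cases "odd i")
      case True
      then have "i - 1 < N" using that by (cases i) auto
      then show ?thesis using True by (auto simp: last_def)
    qed (simp add: last_def)
  qed (auto simp: sq_integrable_predicted_block L2norm_predicted_block predicted_norm_nonneg)
  have "AE \<omega> in M. \<forall>l. ?Y (Suc j) l \<omega> = ?Y j (2 * l) \<omega> + ?E l \<omega>"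
    using predicted_block_Suc by (simp add: AE_all_countable)
  then have "AE \<omega> in M. \<forall>i. (\<Sum>k<i. ?Y j k \<omega>)
      = ((\<Sum>l<i div 2. ?Y (Suc j) l \<omega>) + (\<Sum>l<i div 2. D l \<omega>)) + last i \<omega>"
  proof eventually_elim
    case (elim \<omega>)
    then show ?case
      by (subst sum_pairs) (simp add: last_def D_def flip: sum.distrib)
  qed
  then have eq: "AE \<omega> in M. \<forall>i\<le>N. \<bar>\<Sum>k<i. ?Y j k \<omega>\<bar>
      \<le> \<bar>(\<Sum>l<i div 2. ?Y (Suc j) l \<omega>) + (\<Sum>l<i div 2. D l \<omega>)\<bar> + \<bar>last i \<omega>\<bar>"
    by eventually_elim (auto intro: abs_triangle_ineq)
  have "max_L2_le M (\<lambda>i \<omega>. (\<Sum>l<i div 2. ?Y (Suc j) l \<omega>) + (\<Sum>l<i div 2. D l \<omega>)) N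
      (c + 2 * sqrt (real (N div 2)) * predicted_norm j)"
    by (rule max_L2_le_add[OF coarse mart]) (auto intro: abs_triangle_ineq)
  from max_L2_le_add[OF this single eq] show ?thesis .
qed

lemma sqrt_div_power2_le: "sqrt (real (n div 2 ^ j)) \<le> sqrt (real n) / 2 powr (real j / 2)"
proof -
  have "sqrt (real (n div 2 ^ j)) \<le> sqrt (real n / 2 ^ j)"
    using of_nat_div_le_of_nat[of n "2 ^ j", where ?'a = real] by simp
  also have "\<dots> = sqrt (real n) / 2 powr (real j / 2)"
    by (simp add: real_sqrt_divide powr_half_sqrt_powr powr_realpow)
  finally show ?thesis .
qed

text \<open>Downward induction on the scale \<open>j\<close>, starting from \<open>j = r - 1\<close>; \<open>d\<close> counts the scales above
  \<open>j\<close>.\<close>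

lemma max_predicted_block:
  assumes "j + Suc d = r" "n \<le> 2 ^ r"
  shows "max_L2_le M (\<lambda>i \<omega>. \<Sum>k<i. predicted_block j k \<omega>) (n div 2 ^ j)
    ((1 + sqrt 2) * sqrt (real n) * (\<Sum>i=j..<r. predicted_norm i / 2 powr (real i / 2)))"
  using assms(1)
proof (induction d arbitrary: j)
  case 0
  let ?N = "n div 2 ^ j" and ?y = "predicted_norm j"
  \<comment> \<open>At the top scale at most two blocks remain, so \<open>N \<le> sqrt 2 * sqrt N\<close>. A further pairing step
    would leave the prediction norm of scale \<open>r\<close>, which is not a term of \<open>\<Delta>\<close>.\<close>
  have "n \<le> 2 * 2 ^ j" using 0 assms(2) by auto
  then have "?N \<le> 2 * 2 ^ j div 2 ^ j" by (rule div_le_mono)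
  then have "?N \<le> 2" by simp
  then have "sqrt (real ?N) \<le> sqrt 2" by simp
  then have "sqrt (real ?N) \<le> 1 + sqrt 2" by linarith
  then have "sqrt (real ?N) * sqrt (real ?N) \<le> (1 + sqrt 2) * sqrt (real ?N)"
    by (rule mult_right_mono) simp
  also have "\<dots> \<le> (1 + sqrt 2) * (sqrt (real n) / 2 powr (real j / 2))"
    by (intro mult_left_mono sqrt_div_power2_le) simp
  finally have "real ?N * ?y \<le> (1 + sqrt 2) * (sqrt (real n) / 2 powr (real j / 2)) * ?y"
    by (intro mult_right_mono predicted_norm_nonneg) simp
  also have "\<dots> = (1 + sqrt 2) * sqrt (real n) * (\<Sum>i=j..<r. predicted_norm i / 2 powr (real i / 2))"
    using 0 by (auto simp: atLeastLessThanSuc)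
  finally show ?case
    by (rule max_L2_le_mono[OF max_L2_le_sum, rotated -1])
       (auto simp: sq_integrable_predicted_block L2norm_predicted_block predicted_norm_nonneg)
next
  case (Suc d)
  let ?N = "n div 2 ^ j" and ?y = "predicted_norm j"
  let ?s = "\<lambda>j. (1 + sqrt 2) * sqrt (real n) * (\<Sum>i=j..<r. predicted_norm i / 2 powr (real i / 2))"
  have half: "n div 2 ^ Suc j = ?N div 2"
    by (simp only: power_Suc2 div_mult2_eq)
  have "max_L2_le M (\<lambda>i \<omega>. \<Sum>k<i. predicted_block (Suc j) k \<omega>) (?N div 2) (?s (Suc j))"
    using Suc.IH[of "Suc j"] Suc.prems unfolding half by simp
  then have "max_L2_le M (\<lambda>i \<omega>. \<Sum>k<i. predicted_block j k \<omega>) ?N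
      (?s (Suc j) + 2 * sqrt (real (?N div 2)) * ?y + sqrt (real ?N) * ?y)"
    by (rule max_predicted_block_step)
  moreover have "?s (Suc j) + 2 * sqrt (real (?N div 2)) * ?y + sqrt (real ?N) * ?y \<le> ?s j"
  proof -
    have "2 * sqrt (real (?N div 2)) = sqrt (4 * real (?N div 2))"
      by (simp add: real_sqrt_mult)
    also have "\<dots> \<le> sqrt (2 * real ?N)"
      using of_nat_div_le_of_nat[of ?N 2, where ?'a = real] by simp
    finally have "2 * sqrt (real (?N div 2)) + sqrt (real ?N) \<le> (1 + sqrt 2) * sqrt (real ?N)"
      by (simp add: real_sqrt_mult distrib_right)
    also have "\<dots> \<le> (1 + sqrt 2) * (sqrt (real n) / 2 powr (real j / 2))"
      by (intro mult_left_mono sqrt_div_power2_le) simp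
    finally have "(2 * sqrt (real (?N div 2)) + sqrt (real ?N)) * ?y
        \<le> (1 + sqrt 2) * (sqrt (real n) / 2 powr (real j / 2)) * ?y"
      by (rule mult_right_mono[OF _ predicted_norm_nonneg])
    moreover have "?s j = (1 + sqrt 2) * (sqrt (real n) / 2 powr (real j / 2)) * ?y + ?s (Suc j)"
      using Suc.prems by (simp add: sum.atLeast_Suc_lessThan distrib_left)
    ultimately show ?thesis by (simp add: distrib_right)
  qed
  ultimately show ?case by (rule max_L2_le_mono)
qed

lemma Delta_eq: "Delta M X r = (\<Sum>j=0..<r. predicted_norm j / 2 powr (real j / 2))"
  unfolding Delta_def predicted_norm_def by (simp add: L2norm_divide lessThan_atLeast0)

lemma block_0: "block 0 k = X (int k + 1)"
  using partial_sum_1[of "shift_process (int k) X"] by (simp add: block_def shift_process_def add.commute)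

lemma L2norm_block_0: "L2norm M (block 0 k) = L2norm M (X 1)"
  unfolding block_0 by (rule L2norm_X)

lemma partial_sum_eq_sum_block: "partial_sum X i \<omega> = (\<Sum>k<i. block 0 k \<omega>)"
proof (induction i)
  case (Suc i)
  then show ?case
    using partial_sum_add[of X i 1 \<omega>] by (simp add: block_def)
qed (simp add: partial_sum_0)

text \<open>Scale 0 is reached by subtracting from each variable its prediction one step ahead; the
  norm of \<open>X 1\<close> enters through the martingale of the prediction errors. For \<open>r = 0\<close> there is no
  scale to sum over, but then \<open>n = 1\<close> and the norm of \<open>X 1\<close> alone is a bound.\<close>

lemma max_partial_sum:
  assumes "1 \<le> n" "n \<le> 2 ^ r"
  shows "max_L2_le M (partial_sum X) n
    (sqrt (real n) * (2 * L2norm M (X 1) + (1 + sqrt 2) * Delta M X r))"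
proof (cases r)
  case 0
  then have "n = 1" using assms by simp
  have "max_L2_le M (\<lambda>i \<omega>. \<Sum>k<i. block 0 k \<omega>) n (real n * L2norm M (X 1))"
    by (rule max_L2_le_sum) (simp_all add: sq_integrable_block L2norm_block_0 L2norm_nonneg)
  then have "max_L2_le M (partial_sum X) n (real n * L2norm M (X 1))"
    by (simp flip: partial_sum_eq_sum_block)
  then show ?thesis
    by (rule max_L2_le_mono) (simp add: \<open>n = 1\<close> 0 Delta_def L2norm_nonneg)
next
  case (Suc d)
  have block_meas: "block 0 k \<in> borel_measurable (block_past 0 (Suc k))" for k
    using measurable_past[of 0 "shift_process (int k + 1) X" M]
    by (simp add: block_0 block_past_def shift_process_def add.commute)
  have mart: "max_L2_le M (\<lambda>i \<omega>. \<Sum>k<i. block 0 k \<omega> - predicted_block 0 k \<omega>) n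
      (2 * sqrt (real n) * L2norm M (X 1))"
    unfolding predicted_block_def
    by (rule Doob_maximal_L2)
       (auto simp: subalgebra_block_past subalgebra_block_past_mono sq_integrable_block block_meas
          L2norm_nonneg L2norm_block_0)
  have pred: "max_L2_le M (\<lambda>i \<omega>. \<Sum>k<i. predicted_block 0 k \<omega>) n
      ((1 + sqrt 2) * sqrt (real n) * Delta M X r)"
    using max_predicted_block[of 0 d r n] Suc assms(2) by (simp add: Delta_eq)
  have "partial_sum X i \<omega> = (\<Sum>k<i. block 0 k \<omega> - predicted_block 0 k \<omega>)
      + (\<Sum>k<i. predicted_block 0 k \<omega>)" for i \<omega>
    by (simp add: partial_sum_eq_sum_block flip: sum.distrib)
  then have "max_L2_le M (partial_sum X) n
      (2 * sqrt (real n) * L2norm M (X 1) + (1 + sqrt 2) * sqrt (real n) * Delta M X r)"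
    by (intro max_L2_le_add[OF mart pred]) (auto intro: abs_triangle_ineq)
  then show ?thesis by (rule max_L2_le_mono) (simp add: algebra_simps)
qed

end

theorem proposition2p3:
  fixes M :: "'a measure" and X :: "int \<Rightarrow> 'a \<Rightarrow> real" and n r :: nat
  assumes "prob_space M"
    and "\<And>i. X i \<in> borel_measurable M"
    and "strictly_stationary M X"
    and "integrable M (\<lambda>\<omega>. (X 1 \<omega>)\<^sup>2)"
    and "n \<ge> 1"
    and "2 powr (real r - 1) < real n"
    and "n \<le> 2 ^ r"
  shows "(\<integral>\<omega>. (MAX i\<in>{1..n}. (partial_sum X i \<omega>)\<^sup>2) \<partial>M)
           \<le> real n * (2 * L2norm M (X 1) + (1 + sqrt 2) * Delta M X r)\<^sup>2"
proof -
  interpret stationary_L2_process M X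
    using assms(1-4) by (simp add: stationary_L2_process_def stationary_L2_process_axioms_def)
  let ?c = "2 * L2norm M (X 1) + (1 + sqrt 2) * Delta M X r"
  obtain K where K: "sq_integrable M K" "AE \<omega> in M. \<forall>i\<le>n. \<bar>partial_sum X i \<omega>\<bar> \<le> K \<omega>"
    "L2norm M K \<le> sqrt (real n) * ?c"
    using max_partial_sum[OF assms(5,7)] by (auto simp: max_L2_le_def)
  have "(\<integral>\<omega>. (MAX i\<in>{1..n}. (partial_sum X i \<omega>)\<^sup>2) \<partial>M) \<le> (\<integral>\<omega>. (K \<omega>)\<^sup>2 \<partial>M)"
  proof (rule integral_mono_AE')
    show "integrable M (\<lambda>\<omega>. (K \<omega>)\<^sup>2)" using K(1) by (simp add: sq_integrable_def)
    show "AE \<omega> in M. (MAX i\<in>{1..n}. (partial_sum X i \<omega>)\<^sup>2) \<le> (K \<omega>)\<^sup>2"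
      using K(2)
    proof eventually_elim
      case (elim \<omega>)
      have "(partial_sum X i \<omega>)\<^sup>2 \<le> (K \<omega>)\<^sup>2" if "i \<in> {1..n}" for i
        using power_mono[of "\<bar>partial_sum X i \<omega>\<bar>" "K \<omega>" 2] elim that by simp
      then show ?case using assms(5) by (subst Max_le_iff) auto
    qed
    show "AE \<omega> in M. 0 \<le> (K \<omega>)\<^sup>2" by simp
  qed
  also have "\<dots> = (L2norm M K)\<^sup>2" by (simp add: L2norm_power2)
  also have "\<dots> \<le> (sqrt (real n) * ?c)\<^sup>2"
    by (rule power_mono[OF K(3) L2norm_nonneg])
  also have "\<dots> = real n * ?c\<^sup>2" by (simp add: power_mult_distrib)
  finally show ?thesis .
qed

end
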